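(* A connected graph $G$ on $n$ vertices satisfies $\Gamma_{\rho}(G)=n-1$ if and only if all of the following hold: (i) $i(G)=2$; (ii) ${\rm diam}(G)\le 4$; (iii) if ${\rm rad}(G)=3$, then there exist a maximal independent set $\{x,y\}$ of $G$ with $d(x,y)=3$ and a vertex $w\in N(x)$ such that $d(w,z)\le 2$ for every vertex $z\in N(y)$; (iv) if ${\rm rad}(G)=2$ and ${\rm diam}(G)=4$, then there exists a maximal independent set $A$ of $G$ with $|A|=2$ that avoids one central vertex $w$ and one additional non-diametrical vertex $z\ne w$ (i.e. $w,z\notin A$).
   Context: Graphs are finite and simple; $d(u,v)$ is the distance in $G$; $N(v)$ is the open neighborhood of $v$. The eccentricity of $v$ is $\max_u d(u,v)$; ${\rm rad}(G)$ and ${\rm diam}(G)$ are the minimum and maximum eccentricity; a central vertex has eccentricity ${\rm rad}(G)$; a diametrical vertex has eccentricity ${\rm diam}(G)$, and a non-diametrical vertex is one that is not diametrical. $i(G)$ is the minimum cardinality of a maximal independent set of $G$ (an $i(G)$-set is a maximal independent set of that cardinality). A packing coloring $c:V(G)\to\{1,\dots,k\}$ satisfies: $c(u)=c(v)=i$, $u\ne v$, implies $d(u,v)>i$. The Grundy packing chromatic number $\Gamma_{\rho}(G)$ is the maximum number of colors $k$ in a packing coloring $c:V(G)\to\{1,\dots,k\}$ using all $k$ colors in which every vertex $v$ with $c(v)=i$ has, for every $j\in\{1,\dots,i-1\}$, a vertex $u$ with $c(u)=j$ and $d(u,v)\le j$ (equivalently, the maximum number of colors produced by the greedy procedure that processes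 vertices in some order and assigns each vertex the smallest color $i$ with no already-colored vertex of color $i$ at distance at most $i$). *)

theory Defs
  imports "Graph_Theory.Graph_Theory" "HOL-Library.Extended_Nat"
begin

text \<open>
  A finite simple graph is an instance of the locale \<^locale>\<open>graph\<close>: a finite, symmetric
  digraph without loops and parallel arcs. Adjacency of \<open>u\<close> and \<open>v\<close> is
  \<open>u \<rightarrow>\<^bsub>G\<^esub> v\<close>.
\<close>

definition open_nbhd :: "('a, 'b) pre_digraph \<Rightarrow> 'a \<Rightarrow> 'a set" where
  "open_nbhd G v = {u \<in> verts G. v \<rightarrow>\<^bsub>G\<^esub> u}"

text \<open>The distance between vertices of different components is \<open>\<infinity>\<close>.\<close>

definition gdist :: "('a, 'b) pre_digraph \<Rightarrow> 'a \<Rightarrow> 'a \<Rightarrow> enat" where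
  "gdist G u v = (INF p \<in> {p. pre_digraph.awalk G u p v}. enat (length p))"

definition eccentricity :: "('a, 'b) pre_digraph \<Rightarrow> 'a \<Rightarrow> enat" where
  "eccentricity G v = Max ((\<lambda>u. gdist G u v) ` verts G)"

definition rad :: "('a, 'b) pre_digraph \<Rightarrow> enat" where
  "rad G = Min (eccentricity G ` verts G)"

definition diam :: "('a, 'b) pre_digraph \<Rightarrow> enat" where
  "diam G = Max (eccentricity G ` verts G)"

definition central_vertex :: "('a, 'b) pre_digraph \<Rightarrow> 'a \<Rightarrow> bool" where
  "central_vertex G v \<longleftrightarrow> v \<in> verts G \<and> eccentricity G v = rad G"

definition diametrical_vertex :: "('a, 'b) pre_digraph \<Rightarrow> 'a \<Rightarrow> bool" where
  "diametrical_vertex G v \<longleftrightarrow> v \<in> verts G \<and> eccentricity G v = diam G"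

definition independent_set :: "('a, 'b) pre_digraph \<Rightarrow> 'a set \<Rightarrow> bool" where
  "independent_set G S \<longleftrightarrow> S \<subseteq> verts G \<and> (\<forall>u \<in> S. \<forall>v \<in> S. \<not> u \<rightarrow>\<^bsub>G\<^esub> v)"

definition maximal_independent_set :: "('a, 'b) pre_digraph \<Rightarrow> 'a set \<Rightarrow> bool" where
  "maximal_independent_set G S \<longleftrightarrow>
     independent_set G S \<and> (\<forall>T. independent_set G T \<and> S \<subseteq> T \<longrightarrow> T = S)"

text \<open>The number \<open>i(G)\<close>.\<close>

definition indep_dom_number :: "('a, 'b) pre_digraph \<Rightarrow> nat" where
  "indep_dom_number G = Min (card ` {S. maximal_independent_set G S})"

definition packing_coloring :: "('a, 'b) pre_digraph \<Rightarrow> nat \<Rightarrow> ('a \<Rightarrow> nat) \<Rightarrow> bool" where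
  "packing_coloring G k c \<longleftrightarrow>
     c ` verts G \<subseteq> {1..k} \<and>
     (\<forall>u \<in> verts G. \<forall>v \<in> verts G. u \<noteq> v \<and> c u = c v \<longrightarrow> enat (c u) < gdist G u v)"

definition grundy_packing_coloring :: "('a, 'b) pre_digraph \<Rightarrow> nat \<Rightarrow> ('a \<Rightarrow> nat) \<Rightarrow> bool" where
  "grundy_packing_coloring G k c \<longleftrightarrow>
     packing_coloring G k c \<and> c ` verts G = {1..k} \<and>
     (\<forall>v \<in> verts G. \<forall>j \<in> {1..<c v}. \<exists>u \<in> verts G. c u = j \<and> gdist G u v \<le> enat j)"

definition grundy_packing_number :: "('a, 'b) pre_digraph \<Rightarrow> nat" where
  "grundy_packing_number G = Max {k. \<exists>c. grundy_packing_coloring G k c}"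

end

theory Submission
  imports Defs
begin

text \<open>
  In a Grundy packing coloring the class of color 1 is a maximal independent set. Hence \<open>n\<close> colors
  occur iff some vertex is adjacent to all others, and \<open>n - 1\<close> colors force a class
  \<open>{x, y}\<close> of color 1 and singletons for all other colors. As \<open>{x, y}\<close> dominates a connected
  graph, \<open>d(x, y) \<in> {2, 3}\<close>, and such a coloring amounts to vertices \<open>w\<close> and \<open>z\<close> (of colors 2 and 3)
  that are within distance 2 and 3, respectively, of all vertices outside \<open>{x, y}\<close>: these
  already bound the diameter by 4, so the colors from 4 on can be distributed arbitrarily.

  A common neighbour of \<open>x\<close> and \<open>y\<close> has eccentricity 2, and on a shortest path \<open>x, a, b, y\<close> both
  \<open>a\<close> and \<open>b\<close> have eccentricity at most 3. So the radius is 2 or 3. If it is 3, then \<open>d(x, y) = 3\<close>,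
  \<open>w\<close> is as in condition (iii), and \<open>z = b\<close> works. If it is 2, a central vertex can
  be taken for \<open>w\<close>, and \<open>z\<close> has to be chosen with care only if the diameter is 4.
\<close>

section \<open>Distances\<close>

text \<open>Lets exact values of \<open>rad\<close> and \<open>diam\<close> be expressed by upper
  bounds alone, which unfold to quantifiers over vertices.\<close>

lemma enat_eq_Suc_iff: "x = enat (Suc k) \<longleftrightarrow> x \<le> enat (Suc k) \<and> \<not> x \<le> enat k"
  by (cases x) auto

lemma (in sym_digraph) awalk_reverse:
  assumes "awalk u p v"
  shows "\<exists>q. awalk v q u \<and> length q = length p"
  using assms
proof (induction p arbitrary: u)
  case Nil
  then show ?case by (auto simp: awalk_Nil_iff intro: exI[of _ "[]"])
next
  case (Cons e p)
  then have e: "e \<in> arcs G" "tail G e = u" and p: "awalk (head G e) p v"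
    by (auto simp: awalk_Cons_iff)
  obtain q where q: "awalk v q (head G e)" "length q = length p"
    using Cons.IH[OF p] by blast
  obtain e' where e': "e' \<in> arcs G" "tail G e' = head G e" "head G e' = u"
    using sym_arcs e unfolding symmetric_conv by metis
  have "awalk v (q @ [e']) u"
    using awalk_appendI[OF q(1)] arc_implies_awalk[OF e'(1)] e' by simp
  then show ?case using q(2) by (intro exI[of _ "q @ [e']"]) simp
qed

locale connected_graph = graph +
  assumes connected: "Digraph_Component.connected G"
begin

text \<open>\<open>the_enat\<close> loses nothing here: connectedness makes all distances between
  vertices finite, see \<open>gdist_eq\<close>.\<close>

definition \<delta> :: "'a \<Rightarrow> 'a \<Rightarrow> nat" where
  "\<delta> u v = the_enat (gdist G u v)"

lemma verts_nonempty: "verts G \<noteq> {}"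
  using connected unfolding connected_def strongly_connected_def by simp

lemma awalk_exists:
  assumes "u \<in> verts G" "v \<in> verts G"
  shows "\<exists>p. awalk u p v"
proof -
  have "u \<rightarrow>\<^sup>*\<^bsub>with_proj (mk_symmetric G)\<^esub> v"
    using connected assms unfolding connected_def strongly_connected_def by simp
  then show ?thesis
    using reachable_mk_symmetric_eq[OF sym_arcs] reachable_awalk by auto
qed

lemma gdist_le_length: "awalk u p v \<Longrightarrow> gdist G u v \<le> enat (length p)"
  unfolding gdist_def by (auto intro: INF_lower)

lemma shortest_awalk:
  assumes "u \<in> verts G" "v \<in> verts G"
  shows "\<exists>p. awalk u p v \<and> gdist G u v = enat (length p)"
proof -
  let ?S = "(\<lambda>p. enat (length p)) ` {p. awalk u p v}"
  have "?S \<noteq> {}" using awalk_exists[OF assms] by auto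
  then have "Inf ?S \<in> ?S"
    unfolding Inf_enat_def by (auto intro: LeastI)
  then show ?thesis unfolding gdist_def by auto
qed

lemma gdist_eq:
  assumes "u \<in> verts G" "v \<in> verts G"
  shows "gdist G u v = enat (\<delta> u v)"
  using shortest_awalk[OF assms] unfolding \<delta>_def by auto

lemma \<delta>_awalk:
  assumes "u \<in> verts G" "v \<in> verts G"
  shows "\<exists>p. awalk u p v \<and> length p = \<delta> u v"
  using shortest_awalk[OF assms] unfolding \<delta>_def by auto

lemma \<delta>_le_length: "awalk u p v \<Longrightarrow> \<delta> u v \<le> length p"
  using gdist_le_length[of u p v] gdist_eq[of u v] by auto

lemma \<delta>_sym: "u \<in> verts G \<Longrightarrow> v \<in> verts G \<Longrightarrow> \<delta> u v = \<delta> v u"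
  by (metis \<delta>_awalk \<delta>_le_length awalk_reverse le_antisym)

lemma \<delta>_triangle:
  "u \<in> verts G \<Longrightarrow> v \<in> verts G \<Longrightarrow> w \<in> verts G \<Longrightarrow> \<delta> u w \<le> \<delta> u v + \<delta> v w"
proof -
  assume uvw: "u \<in> verts G" "v \<in> verts G" "w \<in> verts G"
  obtain p where p: "awalk u p v" "length p = \<delta> u v" using \<delta>_awalk uvw by blast
  obtain q where q: "awalk v q w" "length q = \<delta> v w" using \<delta>_awalk uvw by blast
  show ?thesis using \<delta>_le_length[OF awalk_appendI[OF p(1) q(1)]] p q by simp
qed

lemma \<delta>_refl [simp]: "u \<in> verts G \<Longrightarrow> \<delta> u u = 0"
  using \<delta>_le_length[of u "[]" u] by (simp add: awalk_Nil_iff)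

lemma \<delta>_0_iff: "u \<in> verts G \<Longrightarrow> v \<in> verts G \<Longrightarrow> \<delta> u v = 0 \<longleftrightarrow> u = v"
  by (metis \<delta>_awalk \<delta>_refl awalk_Nil_iff length_0_conv)

lemma \<delta>_1_if_adj:
  assumes "u \<rightarrow> v"
  shows "\<delta> u v = 1"
proof -
  obtain e where "e \<in> arcs G" "tail G e = u" "head G e = v"
    using assms by (rule reachableE)
  then have "\<delta> u v \<le> 1"
    using \<delta>_le_length[OF arc_implies_awalk] by fastforce
  moreover have "\<delta> u v \<noteq> 0"
    using assms adj_not_same adj_in_verts \<delta>_0_iff by metis
  ultimately show ?thesis by simp
qed

lemma \<delta>_Suc:
  assumes "u \<in> verts G" "v \<in> verts G" "\<delta> u v = Suc k"
  shows "\<exists>w\<in>verts G. u \<rightarrow> w \<and> \<delta> w v = k"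
proof -
  obtain e p where p: "awalk u (e # p) v" "length p = k"
    using \<delta>_awalk[OF assms(1,2)] assms(3) by (metis length_Suc_conv)
  then have e: "e \<in> arcs G" "tail G e = u" and w: "awalk (head G e) p v"
    by (auto simp: awalk_Cons_iff)
  have adj: "u \<rightarrow> head G e" using e in_arcs_imp_in_arcs_ends by blast
  then have "\<delta> u v \<le> 1 + \<delta> (head G e) v"
    using \<delta>_triangle[of u "head G e" v] \<delta>_1_if_adj[OF adj] assms adj_in_verts by simp
  then have "\<delta> (head G e) v = k"
    using \<delta>_le_length[OF w] p assms(3) by simp
  then show ?thesis using adj adj_in_verts by blast
qed

lemma adj_iff: "u \<in> verts G \<Longrightarrow> v \<in> verts G \<Longrightarrow> u \<rightarrow> v \<longleftrightarrow> \<delta> u v = 1"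
  using \<delta>_1_if_adj \<delta>_Suc[of u v 0] \<delta>_0_iff by fastforce

lemma \<delta>_Suc':
  assumes "u \<in> verts G" "v \<in> verts G" "\<delta> u v = Suc k"
  shows "\<exists>w\<in>verts G. \<delta> u w = 1 \<and> \<delta> w v = k"
  using \<delta>_Suc[OF assms] \<delta>_1_if_adj by blast

definition ecc_le :: "'a \<Rightarrow> nat \<Rightarrow> bool" where
  "ecc_le v k \<longleftrightarrow> (\<forall>u\<in>verts G. \<delta> v u \<le> k)"

lemma eccentricity_le_iff:
  assumes "v \<in> verts G"
  shows "eccentricity G v \<le> enat k \<longleftrightarrow> ecc_le v k"
  using assms verts_nonempty
  unfolding eccentricity_def ecc_le_def by (simp add: gdist_eq \<delta>_sym[of v])

lemma rad_le_iff: "rad G \<le> enat k \<longleftrightarrow> (\<exists>v\<in>verts G. ecc_le v k)"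
  using verts_nonempty unfolding rad_def by (simp add: Min_le_iff eccentricity_le_iff)

lemma diam_le_iff: "diam G \<le> enat k \<longleftrightarrow> (\<forall>v\<in>verts G. ecc_le v k)"
  using verts_nonempty unfolding diam_def by (simp add: eccentricity_le_iff)

section \<open>Maximal independent sets\<close>

text \<open>These are the independent dominating sets: a vertex outside \<open>S\<close> without a
  neighbour in \<open>S\<close> could be added, a dominated one could not.\<close>

lemma maximal_independent_set_iff:
  "maximal_independent_set G S \<longleftrightarrow>
     S \<subseteq> verts G \<and> (\<forall>u\<in>S. \<forall>v\<in>S. \<delta> u v \<noteq> 1) \<and> (\<forall>v\<in>verts G - S. \<exists>u\<in>S. \<delta> u v = 1)"
    (is "?L \<longleftrightarrow> ?R")
proof -
  have indep: "independent_set G T \<longleftrightarrow> T \<subseteq> verts G \<and> (\<forall>u\<in>T. \<forall>v\<in>T. \<delta> u v \<noteq> 1)" for T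
    unfolding independent_set_def using adj_iff by (meson subsetD)
  show ?thesis
  proof
    assume L: ?L
    have S: "S \<subseteq> verts G" "\<forall>u\<in>S. \<forall>v\<in>S. \<delta> u v \<noteq> 1"
      using L unfolding maximal_independent_set_def indep by auto
    have "\<exists>u\<in>S. \<delta> u v = 1" if v: "v \<in> verts G - S" for v
    proof (rule ccontr)
      assume "\<not> ?thesis"
      then have "independent_set G (insert v S)"
        unfolding indep using S v \<delta>_sym[of v] \<delta>_refl[of v] by (auto simp: subset_iff)
      then have "insert v S = S"
        using L unfolding maximal_independent_set_def by blast
      then show False using v by blast
    qed
    with S show ?R by blast
  next
    assume R: ?R
    then show ?L
      unfolding maximal_independent_set_def indep by blast
  qed
qed

text \<open>Eccentricity at most 1, not exactly 1, so that the vertex of a one-vertex graph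
  counts.\<close>

definition universal :: "'a \<Rightarrow> bool" where
  "universal u \<longleftrightarrow> u \<in> verts G \<and> ecc_le u 1"

text \<open>\<open>2 \<le> \<delta> x y\<close> says at once that \<open>x\<close> and
  \<open>y\<close> are distinct and not adjacent.\<close>

definition dom_pair :: "'a \<Rightarrow> 'a \<Rightarrow> bool" where
  "dom_pair x y \<longleftrightarrow> x \<in> verts G \<and> y \<in> verts G \<and> 2 \<le> \<delta> x y \<and>
     (\<forall>v\<in>verts G - {x, y}. \<delta> x v = 1 \<or> \<delta> y v = 1)"

lemma dom_pair_sym: "dom_pair x y \<Longrightarrow> dom_pair y x"
  unfolding dom_pair_def using \<delta>_sym by auto

lemma maximal_independent_pair_iff:
  "maximal_independent_set G {x, y} \<and> x \<noteq> y \<longleftrightarrow> dom_pair x y"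
proof -
  have ge2: "2 \<le> \<delta> x y \<longleftrightarrow> \<delta> x y \<noteq> 1 \<and> x \<noteq> y" if "x \<in> verts G" "y \<in> verts G"
    using \<delta>_0_iff[OF that] by linarith
  show ?thesis
    unfolding maximal_independent_set_iff dom_pair_def
    using ge2 \<delta>_sym[of x y] by auto
qed

lemma maximal_independent_singleton_iff: "maximal_independent_set G {u} \<longleftrightarrow> universal u"
proof -
  have "\<delta> u v = 1 \<longleftrightarrow> \<delta> u v \<le> 1" if "u \<in> verts G" "v \<in> verts G - {u}" for v
    using \<delta>_0_iff[of u v] that by auto
  then show ?thesis
    unfolding maximal_independent_set_iff universal_def ecc_le_def
    by (metis (no_types, opaque_lifting) Diff_iff \<delta>_refl empty_subsetI insert_subset singletonD singletonI zero_le zero_neq_one)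
qed

section \<open>Colorings\<close>

lemma grundy_packing_coloring_iff:
  "grundy_packing_coloring G k c \<longleftrightarrow> c ` verts G = {1..k} \<and>
     (\<forall>u\<in>verts G. \<forall>v\<in>verts G. u \<noteq> v \<and> c u = c v \<longrightarrow> c u < \<delta> u v) \<and>
     (\<forall>v\<in>verts G. \<forall>j\<in>{1..<c v}. \<exists>u\<in>verts G. c u = j \<and> \<delta> u v \<le> j)"
  unfolding grundy_packing_coloring_def packing_coloring_def
  by (auto simp: gdist_eq)

text \<open>The vertices of \<open>S\<close> are colored one after the other, each with the least
  free color; distances are those of \<open>G\<close> throughout.\<close>

lemma greedy_coloring_exists:
  assumes "S \<subseteq> verts G"
  shows "\<exists>c. (\<forall>v\<in>S. 1 \<le> c v) \<and>
     (\<forall>u\<in>S. \<forall>v\<in>S. u \<noteq> v \<and> c u = c v \<longrightarrow> c u < \<delta> u v) \<and>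
     (\<forall>v\<in>S. \<forall>j\<in>{1..<c v}. \<exists>u\<in>S. c u = j \<and> \<delta> u v \<le> j)"
  using finite_subset[OF assms finite_verts] assms
proof (induction S rule: finite_induct)
  case empty
  then show ?case by simp
next
  case (insert x S)
  obtain c where c: "\<forall>v\<in>S. 1 \<le> c v"
    "\<forall>u\<in>S. \<forall>v\<in>S. u \<noteq> v \<and> c u = c v \<longrightarrow> c u < \<delta> u v"
    "\<forall>v\<in>S. \<forall>j\<in>{1..<c v}. \<exists>u\<in>S. c u = j \<and> \<delta> u v \<le> j"
    using insert.IH insert.prems by auto
  let ?free = "\<lambda>i. 1 \<le> i \<and> (\<forall>u\<in>S. c u = i \<longrightarrow> i < \<delta> u x)"
  define m where "m = (LEAST i. ?free i)"
  \<comment> \<open>A color that does not occur on \<open>S\<close> is free; excluding 0 keeps it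
    positive.\<close>
  obtain i where "i \<notin> c ` S \<union> {0}"
    using insert.hyps(1) ex_new_if_finite[OF infinite_UNIV_nat, of "c ` S \<union> {0}"] by auto
  then have "1 \<le> i" "\<forall>u\<in>S. c u \<noteq> i" by (auto simp: image_iff)
  then have "?free i" by blast
  then have "\<exists>i. ?free i" by blast
  then have m: "?free m" unfolding m_def by (rule LeastI_ex)
  \<comment> \<open>By minimality of \<open>m\<close>, each smaller positive color is blocked by a
    vertex of \<open>S\<close> close to \<open>x\<close>.\<close>
  have below: "\<exists>u\<in>S. c u = j \<and> \<delta> u x \<le> j" if "j \<in> {1..<m}" for j
    using not_less_Least[of j ?free] that unfolding m_def by fastforce
  have sub: "S \<subseteq> verts G" "x \<in> verts G" using insert.prems by auto
  define c' where "c' = c(x := m)"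
  have old: "c' u = c u" if "u \<in> S" for u
    using that insert.hyps(2) unfolding c'_def by auto
  have new: "c' x = m" unfolding c'_def by simp
  have "\<forall>v\<in>insert x S. 1 \<le> c' v" using c(1) m old new by auto
  moreover have "\<forall>u\<in>insert x S. \<forall>v\<in>insert x S. u \<noteq> v \<and> c' u = c' v \<longrightarrow> c' u < \<delta> u v"
  proof (intro ballI impI)
    fix u v assume uv: "u \<in> insert x S" "v \<in> insert x S" "u \<noteq> v \<and> c' u = c' v"
    then consider "u \<in> S" "v \<in> S" | "u = x" "v \<in> S" | "u \<in> S" "v = x" by blast
    then show "c' u < \<delta> u v"
    proof cases
      case 1
      then show ?thesis using c(2) uv old by auto
    next
      case 2
      then have "c v = m" "v \<in> verts G" using uv old new sub by auto
      then show ?thesis using 2 m new \<delta>_sym[of v x] sub by auto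
    next
      case 3
      then show ?thesis using m uv old new by auto
    qed
  qed
  moreover have "\<forall>v\<in>insert x S. \<forall>j\<in>{1..<c' v}. \<exists>u\<in>insert x S. c' u = j \<and> \<delta> u v \<le> j"
    using c(3) below old new by (metis insert_iff)
  ultimately show ?case by blast
qed

text \<open>The largest color is attained at some \<open>v\<close>, and the greedy condition at
  \<open>v\<close> yields every smaller color, so there are no gaps. Existence makes the set behind
  \<open>grundy_packing_number\<close> nonempty and, through the class of color 1, also the set
  behind \<open>indep_dom_number\<close>.\<close>

lemma grundy_coloring_exists: "\<exists>k c. grundy_packing_coloring G k c"
proof -
  obtain c where c: "\<forall>v\<in>verts G. 1 \<le> c v"
    "\<forall>u\<in>verts G. \<forall>v\<in>verts G. u \<noteq> v \<and> c u = c v \<longrightarrow> c u < \<delta> u v"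
    "\<forall>v\<in>verts G. \<forall>j\<in>{1..<c v}. \<exists>u\<in>verts G. c u = j \<and> \<delta> u v \<le> j"
    using greedy_coloring_exists[OF subset_refl] by blast
  define k where "k = Max (c ` verts G)"
  have "k \<in> c ` verts G"
    unfolding k_def using verts_nonempty by (intro Max_in) auto
  then obtain v where v: "v \<in> verts G" "c v = k" by auto
  have "c ` verts G = {1..k}"
  proof
    show "c ` verts G \<subseteq> {1..k}" using c(1) unfolding k_def by auto
    show "{1..k} \<subseteq> c ` verts G"
    proof
      fix j assume "j \<in> {1..k}"
      then have "j = k \<or> j \<in> {1..<c v}" using v by auto
      then show "j \<in> c ` verts G" using c(3) v by (metis imageI image_iff)
    qed
  qed
  then show ?thesis unfolding grundy_packing_coloring_iff using c by blast
qed

lemma grundy_coloring_le_card: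
  "grundy_packing_coloring G k c \<Longrightarrow> k \<le> card (verts G)"
  using card_image_le[OF finite_verts, of c] unfolding grundy_packing_coloring_iff by simp

text \<open>The maximum ranges over a nonempty set bounded by the order n of \<open>G\<close>, and n
  - 1 differs from n because \<open>G\<close> has a vertex.\<close>

lemma grundy_packing_number_eq_pred_iff:
  "grundy_packing_number G = card (verts G) - 1 \<longleftrightarrow>
     (\<exists>c. grundy_packing_coloring G (card (verts G) - 1) c) \<and>
     \<not> (\<exists>c. grundy_packing_coloring G (card (verts G)) c)"
proof -
  let ?K = "{k. \<exists>c. grundy_packing_coloring G k c}"
  let ?n = "card (verts G)"
  have "?K \<subseteq> {..?n}" using grundy_coloring_le_card by auto
  then have fin: "finite ?K" by (rule finite_subset) simp
  have ne: "?K \<noteq> {}" using grundy_coloring_exists by auto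
  have n: "0 < ?n" using verts_nonempty by (simp add: card_gt_0_iff)
  have "Max ?K = ?n - 1 \<longleftrightarrow> ?n - 1 \<in> ?K \<and> (\<forall>k\<in>?K. k \<le> ?n - 1)"
    by (rule Max_eq_iff[OF fin ne])
  also have "(\<forall>k\<in>?K. k \<le> ?n - 1) \<longleftrightarrow> ?n \<notin> ?K"
    using \<open>?K \<subseteq> {..?n}\<close> n
    by (metis (no_types, lifting) Suc_pred' atMost_iff le_SucE not_less_eq_eq order_refl subsetD)
  finally show ?thesis unfolding grundy_packing_number_def by simp
qed

text \<open>Distinct vertices of color 1 are at distance more than 1, and the greedy condition for
  \<open>j = 1\<close> gives every other vertex a neighbour of color 1.\<close>

lemma first_color_class:
  assumes "grundy_packing_coloring G k c"
  shows "maximal_independent_set G {v\<in>verts G. c v = 1}"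
  unfolding maximal_independent_set_iff
proof (intro conjI ballI)
  fix u v assume "u \<in> {v\<in>verts G. c v = 1}" "v \<in> {v\<in>verts G. c v = 1}"
  then show "\<delta> u v \<noteq> 1"
    using assms \<delta>_refl[of u] unfolding grundy_packing_coloring_iff
    by (metis (mono_tags, lifting) less_irrefl mem_Collect_eq zero_neq_one)
next
  fix v assume v: "v \<in> verts G - {v\<in>verts G. c v = 1}"
  then have "c v \<in> {1..k}" using assms unfolding grundy_packing_coloring_iff by blast
  then have "1 \<in> {1..<c v}" using v by auto
  then obtain u where u: "u \<in> verts G" "c u = 1" "\<delta> u v \<le> 1"
    using assms v unfolding grundy_packing_coloring_iff by (metis DiffD1)
  moreover have "\<delta> u v \<noteq> 0" using u v \<delta>_0_iff[of u v] by auto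
  ultimately show "\<exists>u\<in>{v\<in>verts G. c v = 1}. \<delta> u v = 1" by auto
qed auto

text \<open>A maximal independent set is nonempty because \<open>G\<close> is, and one of size 1
  consists of a universal vertex.\<close>

lemma indep_dom_number_eq_2_iff:
  "indep_dom_number G = 2 \<longleftrightarrow> (\<exists>x y. dom_pair x y) \<and> \<not> (\<exists>u. universal u)"
proof -
  let ?M = "{S. maximal_independent_set G S}"
  have sub: "?M \<subseteq> Pow (verts G)" unfolding maximal_independent_set_iff by auto
  then have fin: "finite ?M" by (rule finite_subset) simp
  have ne: "?M \<noteq> {}" using grundy_coloring_exists first_color_class by blast
  have "indep_dom_number G = 2 \<longleftrightarrow> 2 \<in> card ` ?M \<and> (\<forall>k\<in>card ` ?M. 2 \<le> k)"
    unfolding indep_dom_number_def using fin ne by (intro Min_eq_iff) auto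
  also have "2 \<in> card ` ?M \<longleftrightarrow> (\<exists>x y. dom_pair x y)"
  proof
    assume "2 \<in> card ` ?M"
    then obtain S where "maximal_independent_set G S" "card S = 2" by auto
    then show "\<exists>x y. dom_pair x y"
      using maximal_independent_pair_iff by (metis card_2_iff)
  next
    assume "\<exists>x y. dom_pair x y"
    then obtain x y where "maximal_independent_set G {x, y}" "x \<noteq> y"
      using maximal_independent_pair_iff by blast
    then show "2 \<in> card ` ?M" by (intro image_eqI[of _ _ "{x, y}"]) auto
  qed
  also have "(\<forall>k\<in>card ` ?M. 2 \<le> k) \<longleftrightarrow> \<not> (\<exists>u. universal u)"
  proof
    assume "\<forall>k\<in>card ` ?M. 2 \<le> k"
    then show "\<not> (\<exists>u. universal u)"
      using maximal_independent_singleton_iff by force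
  next
    assume nu: "\<not> (\<exists>u. universal u)"
    show "\<forall>k\<in>card ` ?M. 2 \<le> k"
    proof
      fix k assume "k \<in> card ` ?M"
      then obtain S where S: "maximal_independent_set G S" "k = card S" by auto
      then have "finite S" using sub finite_subset finite_verts by blast
      moreover have "S \<noteq> {}"
        using S verts_nonempty unfolding maximal_independent_set_iff by auto
      ultimately have "k \<noteq> 0" using S by simp
      moreover have "k \<noteq> 1"
        using S nu maximal_independent_singleton_iff by (metis card_1_singletonE)
      ultimately show "2 \<le> k" by simp
    qed
  qed
  finally show ?thesis .
qed

text \<open>With as many colors as vertices the coloring is injective, so the class of color 1 is a
  singleton. Conversely, a universal vertex gets color 1; all distances are at most 2, so any
  bijection can assign the other colors.\<close>

lemma full_coloring_iff_universal:
  "(\<exists>c. grundy_packing_coloring G (card (verts G)) c) \<longleftrightarrow> (\<exists>u. universal u)"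
proof
  let ?n = "card (verts G)"
  have n: "0 < ?n" using verts_nonempty by (simp add: card_gt_0_iff)
  assume "\<exists>c. grundy_packing_coloring G ?n c"
  then obtain c where c: "grundy_packing_coloring G ?n c" by blast
  then have im: "c ` verts G = {1..?n}" unfolding grundy_packing_coloring_iff by blast
  then have inj: "inj_on c (verts G)" by (intro eq_card_imp_inj_on) auto
  obtain u where u: "u \<in> verts G" "c u = 1" using im n by (metis One_nat_def Suc_leI atLeastAtMost_iff imageE le_refl)
  have "{v\<in>verts G. c v = 1} = {u}"
    using u inj by (auto simp: inj_on_def)
  then show "\<exists>u. universal u"
    using first_color_class[OF c] maximal_independent_singleton_iff by auto
next
  let ?n = "card (verts G)"
  assume "\<exists>u. universal u"
  then obtain u where u: "u \<in> verts G" and adj: "\<And>v. v \<in> verts G \<Longrightarrow> \<delta> u v \<le> 1"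
    unfolding universal_def ecc_le_def by blast
  have n: "0 < ?n" using verts_nonempty by (simp add: card_gt_0_iff)
  have "card (verts G - {u}) = card {2..?n}" using u by simp
  then obtain f where f: "bij_betw f (verts G - {u}) {2..?n}"
    using finite_same_card_bij[of "verts G - {u}" "{2..?n}"] by auto
  define c where "c v = (if v = u then 1 else f v)" for v
  have fim: "f ` (verts G - {u}) = {2..?n}" using f by (rule bij_betw_imp_surj_on)
  have "c ` verts G = insert 1 (f ` (verts G - {u}))"
    using u unfolding c_def by auto
  then have im: "c ` verts G = {1..?n}" using fim n by auto
  then have inj: "inj_on c (verts G)" by (intro eq_card_imp_inj_on) auto
  have "\<exists>w\<in>verts G. c w = j \<and> \<delta> w v \<le> j" if v: "v \<in> verts G" and j: "j \<in> {1..<c v}" for v j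
  proof -
    have "c v \<in> {1..?n}" using im v by blast
    then have "j \<in> c ` verts G" using j unfolding im by auto
    then obtain w where w: "w \<in> verts G" "c w = j" by auto
    show ?thesis
    proof (cases "w = u")
      case True
      then show ?thesis using u adj v w j by fastforce
    next
      case False
      then have "2 \<le> j" using w fim unfolding c_def by auto
      then show ?thesis
        using \<delta>_triangle[of w u v] \<delta>_sym[of w u] adj[OF v] adj[OF w(1)] u v w by fastforce
    qed
  qed
  then have "grundy_packing_coloring G ?n c"
    unfolding grundy_packing_coloring_iff using im inj by (auto dest: inj_onD)
  then show "\<exists>c. grundy_packing_coloring G ?n c" by blast
qed

section \<open>Dominating pairs\<close>

text \<open>On a shortest path from \<open>x\<close> to \<open>y\<close>, the vertex
  \<open>b\<close> two steps after \<open>x\<close> is not adjacent to \<open>x\<close>. Hence it is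
  \<open>y\<close> or adjacent to \<open>y\<close>.\<close>

lemma dom_pair_cases:
  assumes "dom_pair x y"
  obtains (common_neighbour) c where "c \<in> verts G" "\<delta> x c = 1" "\<delta> y c = 1" "\<delta> x y = 2"
  | (path) a b where "a \<in> verts G" "b \<in> verts G" "\<delta> x a = 1" "\<delta> a b = 1" "\<delta> y b = 1"
      "\<delta> x y = 3"
proof -
  have xy: "x \<in> verts G" "y \<in> verts G" "2 \<le> \<delta> x y"
    using assms unfolding dom_pair_def by auto
  obtain k where k: "\<delta> x y = Suc (Suc k)"
    using xy(3) by (metis Suc_le_D Suc_le_mono numeral_2_eq_2)
  obtain a where a: "a \<in> verts G" "\<delta> x a = 1" "\<delta> a y = Suc k"
    using \<delta>_Suc'[OF xy(1,2) k] by blast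
  obtain b where b: "b \<in> verts G" "\<delta> a b = 1" "\<delta> b y = k"
    using \<delta>_Suc'[OF a(1) xy(2) a(3)] by blast
  show thesis
  proof (cases "k = 0")
    case True
    then show thesis
      using common_neighbour[of a] a k xy \<delta>_sym[of a y] by simp
  next
    case False
    then have "b \<noteq> y" using b xy by auto
    moreover have "b \<noteq> x" using b k by auto
    ultimately have "\<delta> x b = 1 \<or> \<delta> y b = 1"
      using assms b unfolding dom_pair_def by blast
    moreover have "\<delta> x b \<noteq> 1"
      using \<delta>_triangle[of x b y] xy b k by auto
    ultimately have "\<delta> y b = 1" by blast
    then show thesis
      using path[of a b] a b k xy \<delta>_sym[of b y] by simp
  qed
qed

lemma dom_pair_dist_le: "dom_pair x y \<Longrightarrow> \<delta> x y \<le> 3"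
  by (erule dom_pair_cases) auto

lemma dom_pair_vertex_cases:
  assumes "dom_pair x y" "v \<in> verts G"
  obtains "v = x" | "v = y" | "v \<noteq> x" "v \<noteq> y" "\<delta> x v = 1" | "v \<noteq> x" "v \<noteq> y" "\<delta> y v = 1"
  using assms unfolding dom_pair_def by blast

text \<open>One step leads from \<open>c\<close> to \<open>x\<close> or \<open>y\<close>, and one
  more to any other vertex.\<close>

lemma common_neighbour_ecc:
  assumes "dom_pair x y" "c \<in> verts G" "\<delta> x c = 1" "\<delta> y c = 1"
  shows "ecc_le c 2"
  unfolding ecc_le_def
proof
  fix v assume v: "v \<in> verts G"
  have xy: "x \<in> verts G" "y \<in> verts G" using assms(1) unfolding dom_pair_def by auto
  show "\<delta> c v \<le> 2"
    using \<delta>_triangle[of c x v] \<delta>_triangle[of c y v] \<delta>_sym[of c x] \<delta>_sym[of c y] assms(2-) xy v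
    by (cases rule: dom_pair_vertex_cases[OF assms(1) v]) auto
qed

text \<open>From \<open>a\<close> it is one step to \<open>x\<close> and at most two to
  \<open>y\<close>; one more reaches everything else. \<open>greedy_start_rad_2\<close> applies this
  to a path not known to be shortest.\<close>

lemma path_ecc:
  assumes "dom_pair x y" "a \<in> verts G" "b \<in> verts G" "\<delta> x a = 1" "\<delta> a b = 1" "\<delta> y b = 1"
  shows "ecc_le a 3"
  unfolding ecc_le_def
proof
  fix v assume v: "v \<in> verts G"
  have xy: "x \<in> verts G" "y \<in> verts G" using assms(1) unfolding dom_pair_def by auto
  have "\<delta> a x = 1" "\<delta> a y \<le> 2"
    using \<delta>_triangle[of a b y] \<delta>_sym[of a x] \<delta>_sym[of b y] assms(2-) xy by auto
  then show "\<delta> a v \<le> 3"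
    using \<delta>_triangle[of a x v] \<delta>_triangle[of a y v] assms(2) xy v
    by (cases rule: dom_pair_vertex_cases[OF assms(1) v]) auto
qed

text \<open>Consequently a radius above 2 is exactly 3, the case of condition (iii).\<close>

lemma dom_pair_rad:
  assumes "dom_pair x y"
  shows "\<exists>v\<in>verts G. ecc_le v 3"
  using assms
proof (cases rule: dom_pair_cases)
  case (common_neighbour c)
  then have "ecc_le c 2" using common_neighbour_ecc[OF assms] by blast
  then have "ecc_le c 3" unfolding ecc_le_def by fastforce
  then show ?thesis using common_neighbour by blast
next
  case (path a b)
  then show ?thesis using path_ecc[OF assms] by blast
qed

text \<open>A common neighbour of the pair has the required eccentricity. Without one,
  \<open>x\<close> and \<open>y\<close> are at distance 3, so \<open>r\<close> itself is neither of
  them.\<close>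

lemma dom_pair_central:
  assumes dp: "dom_pair x y" and r: "r \<in> verts G" "ecc_le r 2"
  shows "\<exists>c\<in>verts G - {x, y}. ecc_le c 2"
  using dp
proof (cases rule: dom_pair_cases)
  case (common_neighbour c)
  then have "c \<noteq> x" "c \<noteq> y" by auto
  then show ?thesis using common_neighbour common_neighbour_ecc[OF dp] by blast
next
  case (path a b)
  have xy: "x \<in> verts G" "y \<in> verts G" using dp unfolding dom_pair_def by auto
  then have "\<not> \<delta> x y \<le> 2" "\<not> \<delta> y x \<le> 2" using path \<delta>_sym[of x y] by auto
  then have "\<not> ecc_le x 2" "\<not> ecc_le y 2" unfolding ecc_le_def using xy by blast+
  then show ?thesis using r by blast
qed

text \<open>Guarantees a further vertex to carry color 3. On three vertices only \<open>w\<close>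
  could lie between \<open>x\<close> and \<open>y\<close>, and it would be universal.\<close>

lemma dom_pair_card:
  assumes dp: "dom_pair x y" and nu: "\<not> (\<exists>u. universal u)"
  shows "verts G \<noteq> {x, y, w}"
proof
  assume V: "verts G = {x, y, w}"
  then have xyw: "x \<in> verts G" "y \<in> verts G" "w \<in> verts G" by auto
  have "universal w" using dp
  proof (cases rule: dom_pair_cases)
    case (common_neighbour c)
    then have "c \<noteq> x" "c \<noteq> y" by auto
    then have "c = w" using common_neighbour V by blast
    then show ?thesis
      unfolding universal_def ecc_le_def
      using common_neighbour V xyw \<delta>_sym[of w x] \<delta>_sym[of w y] by simp
  next
    case (path a b)
    have "a \<noteq> x" "a \<noteq> y" "b \<noteq> y" "b \<noteq> x" using path \<delta>_sym[of x y] xyw by auto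
    then have "a = w" "b = w" using path V by auto
    \<comment> \<open>Both inner vertices would be \<open>w\<close>, although they are at distance
      1.\<close>
    then show ?thesis using path by auto
  qed
  then show False using nu by blast
qed

text \<open>The classes of the colors 1, 2 and 3 are \<open>{x, y}\<close>, \<open>{w}\<close> and \<open>{z}\<close>; the distance
  condition on \<open>w\<close> and \<open>z\<close> is all that the later colors ask for when the diameter is at most 4.\<close>

definition greedy_start :: "'a \<Rightarrow> 'a \<Rightarrow> 'a \<Rightarrow> 'a \<Rightarrow> bool" where
  "greedy_start x y w z \<longleftrightarrow> dom_pair x y \<and> w \<in> verts G - {x, y} \<and> z \<in> verts G - {x, y, w} \<and>
     (\<forall>u\<in>verts G - {x, y}. \<delta> w u \<le> 2 \<and> \<delta> z u \<le> 3)"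

section \<open>Colorings with n - 1 colors and greedy starts\<close>

lemma greedy_start_sym: "greedy_start x y w z \<Longrightarrow> greedy_start y x w z"
  unfolding greedy_start_def using dom_pair_sym by auto

text \<open>With one color fewer than vertices, only two vertices can share a color. Without a
  universal vertex the class of color 1 is not a singleton, so the coincidence occurs there and all
  later colors are unique.\<close>

lemma coloring_imp_greedy_start:
  assumes c: "grundy_packing_coloring G (card (verts G) - 1) c"
    and nu: "\<not> (\<exists>u. universal u)"
  shows "\<exists>x y w z. greedy_start x y w z"
proof -
  let ?V = "verts G" and ?n = "card (verts G)"
  have im: "c ` ?V = {1..?n - 1}"
    and below: "\<And>v j. v \<in> ?V \<Longrightarrow> 1 \<le> j \<Longrightarrow> j < c v \<Longrightarrow> \<exists>u\<in>?V. c u = j \<and> \<delta> u v \<le> j"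
    using c unfolding grundy_packing_coloring_iff by auto
  let ?A = "{v\<in>?V. c v = 1}"
  have A: "maximal_independent_set G ?A" using first_color_class[OF c] .
  obtain v where v: "v \<in> ?V" using verts_nonempty by auto
  have "?A \<noteq> {}" using A v unfolding maximal_independent_set_iff by blast
  then obtain x where x: "x \<in> ?V" "c x = 1" by auto
  have "?A \<noteq> {x}" using A nu maximal_independent_singleton_iff by metis
  then obtain y where y: "y \<in> ?V" "c y = 1" "x \<noteq> y" using x by auto
  \<comment> \<open>Removing \<open>y\<close> loses no color, since \<open>x\<close> has the same
    one; then n - 1 colors on n - 1 vertices make \<open>c\<close> injective.\<close>
  have "c ` ?V = insert (c y) (c ` (?V - {y}))"
    using y(1) by (metis image_insert insert_Diff)
  moreover have "c y \<in> c ` (?V - {y})" using x y by (intro image_eqI[of _ _ x]) auto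
  ultimately have "c ` (?V - {y}) = c ` ?V" by auto
  then have inj: "inj_on c (?V - {y})"
    using im y by (intro eq_card_imp_inj_on) auto
  have "u = x" if "u \<in> ?A" "u \<noteq> y" for u
    using inj_onD[OF inj, of u x] that x y by simp
  then have "?A \<subseteq> {x, y}" by blast
  moreover have "{x, y} \<subseteq> ?A" using x y by simp
  ultimately have "?A = {x, y}" by (rule subset_antisym)
  then have dp: "dom_pair x y" using A y maximal_independent_pair_iff by auto
  have single: "u = v" if "u \<in> ?V - {x, y}" "v \<in> ?V" "c u = c v" for u v
    using inj that x y unfolding inj_on_def by (metis Diff_iff insertCI singletonD)
  have pos: "1 < c u" if "u \<in> ?V - {x, y}" for u
    using that im \<open>?A = {x, y}\<close>
    by (metis (mono_tags, lifting) Diff_iff atLeastAtMost_iff imageI le_neq_implies_less mem_Collect_eq)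
  have "?V \<noteq> {x, y}"
    using dp by (elim dom_pair_cases) auto
  then obtain u0 where u0: "u0 \<in> ?V - {x, y}" using x y by blast
  have range: "c u \<in> {1..?n - 1}" if "u \<in> ?V - {x, y}" for u using im that by blast
  have "2 \<in> c ` ?V" unfolding im using pos[OF u0] range[OF u0] by simp
  then obtain w where w: "w \<in> ?V" "c w = 2" by auto
  then have wW: "w \<in> ?V - {x, y}" using x y by auto
  \<comment> \<open>Color 2 occurs only at \<open>w\<close>. The greedy condition covers the
    vertices of larger color, and \<open>w\<close> has distance 0 to itself.\<close>
  have w2: "\<delta> w u \<le> 2" if u: "u \<in> ?V - {x, y}" for u
  proof (cases "c u = 2")
    case True
    then show ?thesis using single[OF u w(1)] w by auto
  next
    case False
    then obtain w' where "w' \<in> ?V" "c w' = 2" "\<delta> w' u \<le> 2"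
      using below[of u 2] pos[OF u] u by auto
    then show ?thesis using single[OF wW] w by metis
  qed
  \<comment> \<open>A vertex beyond \<open>x\<close>, \<open>y\<close>, \<open>w\<close> has color
    at least 3, so color 3 occurs.\<close>
  have "?V \<noteq> {x, y, w}" using dom_pair_card[OF dp nu] .
  then obtain u1 where u1: "u1 \<in> ?V - {x, y}" "u1 \<noteq> w" using x y w by blast
  have "c u1 \<noteq> 2" using single[OF u1(1) w(1)] w u1 by auto
  then have "3 \<le> c u1" using pos[OF u1(1)] by simp
  then have "3 \<in> c ` ?V" unfolding im using range[OF u1(1)] by simp
  then obtain z where z: "z \<in> ?V" "c z = 3" by auto
  then have zW: "z \<in> ?V - {x, y}" "z \<noteq> w" using x y w by auto
  have "\<delta> z u \<le> 3" if u: "u \<in> ?V - {x, y}" for u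
  proof -
    consider "c u = 2" | "c u = 3" | "3 < c u" using pos[OF u] by linarith
    then show ?thesis
    proof cases
      case 1
      then have "u = w" using single[OF u w(1)] w by simp
      \<comment> \<open>The greedy condition at \<open>w\<close> does not reach color 3; the bound
        for \<open>w\<close> and symmetry serve instead.\<close>
      then show ?thesis using w2[OF zW(1)] \<delta>_sym[of w z] w z by simp
    next
      case 2
      then show ?thesis using single[OF u z(1)] z by auto
    next
      case 3
      then obtain z' where "z' \<in> ?V" "c z' = 3" "\<delta> z' u \<le> 3"
        using below[of u 3] u by auto
      then show ?thesis using single[OF zW(1)] z by metis
    qed
  qed
  then show ?thesis
    unfolding greedy_start_def using dp wW zW w2 by blast
qed

lemma greedy_start_imp_coloring:
  assumes gs: "greedy_start x y w z" and diam: "\<And>v. v \<in> verts G \<Longrightarrow> ecc_le v 4"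
  shows "\<exists>c. grundy_packing_coloring G (card (verts G) - 1) c"
proof -
  let ?V = "verts G" and ?n = "card (verts G)"
  have dp: "dom_pair x y" and w: "w \<in> ?V" "w \<noteq> x" "w \<noteq> y"
    and z: "z \<in> ?V" "z \<noteq> x" "z \<noteq> y" "z \<noteq> w"
    and w2: "\<And>u. u \<in> ?V - {x, y} \<Longrightarrow> \<delta> w u \<le> 2"
    and z3: "\<And>u. u \<in> ?V - {x, y} \<Longrightarrow> \<delta> z u \<le> 3"
    using gs unfolding greedy_start_def by auto
  have xy: "x \<in> ?V" "y \<in> ?V" "2 \<le> \<delta> x y"
    using dp unfolding dom_pair_def by auto
  then have "x \<noteq> y" by auto
  let ?R = "?V - {x, y, w, z}"
  have card4: "card {x, y, w, z} = 4" using \<open>x \<noteq> y\<close> w z by auto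
  have n4: "4 \<le> ?n" using card_mono[of ?V "{x, y, w, z}"] card4 xy w z by auto
  \<comment> \<open>The n - 4 other vertices receive the colors 4 to n - 1: color 1 is used
    twice.\<close>
  have "card ?R = card {4..<?n}" using card4 xy w z by (simp add: card_Diff_subset)
  then obtain f where f: "bij_betw f ?R {4..<?n}"
    using finite_same_card_bij[of ?R "{4..<?n}"] by auto
  have fim: "f ` ?R = {4..<?n}" using f by (rule bij_betw_imp_surj_on)
  define c where "c v = (if v = x \<or> v = y then 1 else if v = w then 2 else if v = z then 3 else f v)"
    for v
  have "?V = ?R \<union> {x, y, w, z}" using xy w z by auto
  then have "c ` ?V = c ` ?R \<union> c ` {x, y, w, z}" by (metis image_Un)
  also have "c ` ?R = f ` ?R" unfolding c_def by (intro image_cong) auto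
  also have "c ` {x, y, w, z} = {1, 2, 3}" unfolding c_def using w z by auto
  finally have im: "c ` ?V = {1..?n - 1}" using fim n4 by auto
  have cR: "4 \<le> c v \<and> c v = f v" if "v \<in> ?R" for v
    using that fim unfolding c_def by auto
  have cv: "c x = 1" "c y = 1" "c w = 2" "c z = 3" unfolding c_def using w z by auto
  have R_iff: "v \<in> ?R \<longleftrightarrow> 4 \<le> c v" if "v \<in> ?V" for v
    using cR[of v] cv that by (cases "v \<in> {x, y, w, z}") auto
  have "c u < \<delta> u v" if uv: "u \<in> ?V" "v \<in> ?V" "u \<noteq> v" "c u = c v" for u v
  proof -
    have "\<not> (u \<in> ?R \<and> v \<in> ?R)"
      using f uv cR unfolding bij_betw_def inj_on_def by metis
    then have "u \<notin> ?R" "v \<notin> ?R" using R_iff uv by metis+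
    then have "u \<in> {x, y, w, z}" "v \<in> {x, y, w, z}" using uv by blast+
    \<comment> \<open>The only repeated color is 1, and \<open>x\<close> and \<open>y\<close> are at
      distance at least 2.\<close>
    then have "u = x \<and> v = y \<or> u = y \<and> v = x" using uv(3,4) cv by auto
    then show ?thesis using xy cv \<delta>_sym[of x y] by auto
  qed
  moreover have "\<exists>u\<in>?V. c u = j \<and> \<delta> u v \<le> j" if v: "v \<in> ?V" and j: "1 \<le> j" "j < c v" for v j
  proof -
    have W: "v \<in> ?V - {x, y}" using v j cv by auto
    consider "j = 1" | "j = 2" | "j = 3" | "4 \<le> j" using j by linarith
    then show ?thesis
    proof cases
      case 1
      then show ?thesis using dp W xy cv unfolding dom_pair_def by (metis order_refl)
    next
      case 2
      then show ?thesis using w2[OF W] w cv by auto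
    next
      case 3
      then show ?thesis using z3[OF W] z cv by auto
    next
      case 4
      have "c v \<in> {1..?n - 1}" using im v by blast
      then have "j \<in> c ` ?V" using j unfolding im by auto
      then obtain u where u: "u \<in> ?V" "c u = j" by auto
      then have "\<delta> u v \<le> 4" using diam v unfolding ecc_le_def by blast
      then show ?thesis using u 4 by auto
    qed
  qed
  ultimately have "grundy_packing_coloring G (?n - 1) c"
    unfolding grundy_packing_coloring_iff using im by auto
  then show ?thesis by blast
qed

section \<open>Necessity: what a greedy start implies\<close>

text \<open>From \<open>x\<close> or \<open>y\<close> the other one is at most 3 away and its
  neighbours at most 4. Two vertices with a common neighbour in the pair are at distance at most 2.
  Otherwise one of them, \<open>s\<close>, shares a neighbour \<open>a\<close> in the pair with
  \<open>w\<close>, and going from \<open>s\<close> over \<open>a\<close> and \<open>w\<close> to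
  the other costs at most 1 + 1 + 2.\<close>

lemma greedy_start_diam:
  assumes gs: "greedy_start x y w z" and u: "u \<in> verts G"
  shows "ecc_le u 4"
  unfolding ecc_le_def
proof
  fix v assume v: "v \<in> verts G"
  have dp: "dom_pair x y" using gs unfolding greedy_start_def by blast
  have far: "\<delta> a s \<le> 4" if "dom_pair a b" "s \<in> verts G" for a b s
  proof -
    have "a \<in> verts G" "b \<in> verts G" using that(1) unfolding dom_pair_def by auto
    then show ?thesis
      using that(2) \<delta>_triangle[of a b s] dom_pair_dist_le[OF that(1)]
      by (cases rule: dom_pair_vertex_cases[OF that]) auto
  qed
  have near: "\<delta> s t \<le> 4"
    if gs: "greedy_start a b w z" and s: "s \<in> verts G" "s \<noteq> a" "s \<noteq> b" "\<delta> a s = 1"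
      and t: "t \<in> verts G" "t \<noteq> a" "t \<noteq> b" and wa: "\<delta> a w = 1" for a b s t
  proof -
    have V: "a \<in> verts G" "w \<in> verts G" and "\<delta> w t \<le> 2"
      using gs t unfolding greedy_start_def dom_pair_def by auto
    then show ?thesis
      using \<delta>_triangle[of s a t] \<delta>_triangle[of a w t] \<delta>_sym[of s a] s t wa by simp
  qed
  have same: "\<delta> s t \<le> 4"
    if "a \<in> verts G" "s \<in> verts G" "t \<in> verts G" "\<delta> a s = 1" "\<delta> a t = 1" for a s t
    using \<delta>_triangle[of s a t] \<delta>_sym[of s a] that by simp
  have xy: "x \<in> verts G" "y \<in> verts G" using dp unfolding dom_pair_def by auto
  have w: "\<delta> x w = 1 \<or> \<delta> y w = 1"
    using gs unfolding greedy_start_def dom_pair_def by blast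
  show "\<delta> u v \<le> 4"
  proof (cases "u \<in> {x, y} \<or> v \<in> {x, y}")
    case True
    then show ?thesis
      using far[OF dp] far[OF dom_pair_sym[OF dp]] u v \<delta>_sym by (metis insertE singletonD)
  next
    case False
    then have ne: "u \<noteq> x" "u \<noteq> y" "v \<noteq> x" "v \<noteq> y" by auto
    have adj: "\<delta> x u = 1 \<or> \<delta> y u = 1" "\<delta> x v = 1 \<or> \<delta> y v = 1"
      using dp u v ne unfolding dom_pair_def by auto
    show ?thesis
    proof (rule ccontr)
      assume c: "\<not> \<delta> u v \<le> 4"
      then have c': "\<not> \<delta> v u \<le> 4" using \<delta>_sym[of u v] u v by simp
      show False
        \<comment> \<open>\<open>near\<close> is needed with \<open>x\<close> and \<open>y\<close>
          interchanged and with \<open>u\<close> and \<open>v\<close> interchanged.\<close>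
        using near[OF gs u ne(1,2) _ v ne(3,4)] near[OF greedy_start_sym[OF gs] u ne(2,1) _ v ne(4,3)]
          near[OF gs v ne(3,4) _ u ne(1,2)] near[OF greedy_start_sym[OF gs] v ne(4,3) _ u ne(2,1)]
          same[OF xy(1) u v] same[OF xy(2) u v] adj w c c' by blast
    qed
  qed
qed

text \<open>By symmetry \<open>w\<close> is adjacent to \<open>x\<close>. A common neighbour of the
  pair would have eccentricity at most 2, so the distance is 3. Then neighbours of \<open>y\<close>
  lie outside the pair, where the bound for \<open>w\<close> holds.\<close>

lemma greedy_start_rad_3:
  assumes gs: "greedy_start x y w z" and no_central: "\<not> (\<exists>v\<in>verts G. ecc_le v 2)"
  shows "\<exists>x y w. dom_pair x y \<and> \<delta> x y = 3 \<and> w \<in> verts G \<and> \<delta> x w = 1 \<and>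
    (\<forall>t\<in>verts G. \<delta> y t = 1 \<longrightarrow> \<delta> w t \<le> 2)"
proof -
  have half: "?thesis" if gs: "greedy_start x y w z" and xw: "\<delta> x w = 1" for x y
  proof -
    have dp: "dom_pair x y" and w: "w \<in> verts G"
      and w2: "\<And>u. u \<in> verts G - {x, y} \<Longrightarrow> \<delta> w u \<le> 2"
      using gs unfolding greedy_start_def by auto
    have xy: "x \<in> verts G" "y \<in> verts G" using dp unfolding dom_pair_def by auto
    have d3: "\<delta> x y = 3" using dp
    proof (cases rule: dom_pair_cases)
      case (common_neighbour c)
      then show ?thesis using common_neighbour_ecc[OF dp] no_central by blast
    qed
    have "\<delta> w t \<le> 2" if "t \<in> verts G" "\<delta> y t = 1" for t
    proof -
      have "t \<noteq> x" "t \<noteq> y" using that d3 \<delta>_sym[of x y] xy by auto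
      then show ?thesis using w2 that by blast
    qed
    then show ?thesis using dp d3 w xw by blast
  qed
  have "\<delta> x w = 1 \<or> \<delta> y w = 1"
    using gs unfolding greedy_start_def dom_pair_def by blast
  then show ?thesis using half[OF gs] half[OF greedy_start_sym[OF gs]] by blast
qed

text \<open>If \<open>w\<close> has eccentricity above 2, it is still at most 3, and
  \<open>w\<close> accompanies a central vertex outside the pair. Otherwise \<open>w\<close> is the
  central one, and \<open>z\<close> accompanies it unless \<open>z\<close> is far from an end of the
  pair; in that case a replacement is found between that end and \<open>w\<close>.\<close>

lemma greedy_start_rad_2:
  assumes gs: "greedy_start x y w z" and r: "r \<in> verts G" "ecc_le r 2"
  shows "\<exists>c\<in>verts G - {x, y}. \<exists>v\<in>verts G - {x, y, c}. ecc_le c 2 \<and> ecc_le v 3"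
proof -
  have dp: "dom_pair x y" and w: "w \<in> verts G - {x, y}" and z: "z \<in> verts G - {x, y, w}"
    and w2: "\<And>u. u \<in> verts G - {x, y} \<Longrightarrow> \<delta> w u \<le> 2"
    and z3: "\<And>u. u \<in> verts G - {x, y} \<Longrightarrow> \<delta> z u \<le> 3"
    using gs unfolding greedy_start_def by auto
  have xy: "x \<in> verts G" "y \<in> verts G" using dp unfolding dom_pair_def by auto
  show ?thesis
  proof (cases "ecc_le w 2")
    case False
    obtain c where c: "c \<in> verts G - {x, y}" "ecc_le c 2"
      using dom_pair_central[OF dp r] by blast
    \<comment> \<open>A neighbour of \<open>x\<close> or \<open>y\<close> outside the pair is within
      distance 2 of \<open>w\<close>, which puts \<open>x\<close> and \<open>y\<close> within
      distance 3.\<close>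
    have nbr: "\<exists>b\<in>verts G - {x, y}. \<delta> s b = 1" if "s = x \<or> s = y" for s
      using dp
    proof (cases rule: dom_pair_cases)
      case (common_neighbour b)
      then have "b \<noteq> x" "b \<noteq> y" by auto
      then show ?thesis using that common_neighbour by blast
    next
      case (path a b)
      have "a \<noteq> x" "a \<noteq> y" "b \<noteq> y" "b \<noteq> x" using path \<delta>_sym[of x y] xy by auto
      then show ?thesis using that path by blast
    qed
    have "\<delta> w s \<le> 3" if s: "s = x \<or> s = y" for s
    proof -
      obtain b where b: "b \<in> verts G - {x, y}" "\<delta> s b = 1" using nbr[OF s] by blast
      then show ?thesis
        using \<delta>_triangle[of w b s] \<delta>_sym[of s b] w2[OF b(1)] w s xy by auto
    qed
    then have "ecc_le w 3" unfolding ecc_le_def using w2 by fastforce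
    then show ?thesis using c w False by blast
  next
    case w_central: True
    show ?thesis
    proof (cases "ecc_le z 3")
      case True
      then show ?thesis using w_central w z by blast
    next
      case False
      have half: "\<exists>v\<in>verts G - {x, y, w}. ecc_le v 3"
        if dp: "dom_pair x y" and gs: "greedy_start x y w z" and far: "3 < \<delta> z x" for x y
      proof -
        have xy: "x \<in> verts G" "y \<in> verts G" using dp unfolding dom_pair_def by auto
        have w: "w \<in> verts G" "w \<noteq> x" "w \<noteq> y" and z: "z \<in> verts G" "z \<noteq> x" "z \<noteq> y" "z \<noteq> w"
          and wz: "\<delta> w z \<le> 2"
          using gs unfolding greedy_start_def by auto
        \<comment> \<open>Otherwise the way from \<open>z\<close> over \<open>w\<close> to
          \<open>x\<close> would have length at most 3. So \<open>w\<close> is adjacent to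
          \<open>y\<close> and two steps from \<open>x\<close>; the vertex \<open>a\<close> between
          completes a path \<open>x\<close>, \<open>a\<close>, \<open>w\<close>,
          \<open>y\<close>.\<close>
        have "\<delta> x w \<noteq> 1"
          using far wz \<delta>_triangle[of z w x] \<delta>_sym[of z w] \<delta>_sym[of x w] xy w z by auto
        then have yw: "\<delta> y w = 1" using dp w unfolding dom_pair_def by blast
        have "\<delta> x w \<noteq> 0" using w xy \<delta>_0_iff[of x w] by auto
        moreover have "\<delta> x w \<le> 2"
          using w_central xy w \<delta>_sym[of x w] unfolding ecc_le_def by auto
        ultimately have "\<delta> x w = Suc 1" using \<open>\<delta> x w \<noteq> 1\<close> by simp
        then obtain a where a: "a \<in> verts G" "\<delta> x a = 1" "\<delta> a w = 1"
          using \<delta>_Suc'[OF xy(1) w(1)] by blast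
        then have "ecc_le a 3" using path_ecc[OF dp a(1) w(1)] yw by blast
        moreover have "a \<noteq> x" "a \<noteq> w" using a xy w by auto
        moreover have "a \<noteq> y" using a dp unfolding dom_pair_def by auto
        ultimately show ?thesis using a by blast
      qed
      obtain s where "s \<in> verts G" "3 < \<delta> z s"
        using False unfolding ecc_le_def by (meson not_le)
      then have "3 < \<delta> z x \<or> 3 < \<delta> z y" using z3 by (metis DiffI empty_iff insert_iff not_le)
      then have "\<exists>v\<in>verts G - {x, y, w}. ecc_le v 3"
        using half[OF dp gs] half[OF dom_pair_sym[OF dp] greedy_start_sym[OF gs]]
        by (auto simp: insert_commute)
      then show ?thesis using w_central w by blast
    qed
  qed
qed

section \<open>Sufficiency: finding a greedy start\<close>

text \<open>Any central vertex outside the pair serves as \<open>w\<close>; every further vertex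
  serves as \<open>z\<close>, its eccentricity being at most 3.\<close>

lemma greedy_start_exists_diam_3:
  assumes dp: "dom_pair x y" and nu: "\<not> (\<exists>u. universal u)"
    and r: "r \<in> verts G" "ecc_le r 2" and diam: "\<And>v. v \<in> verts G \<Longrightarrow> ecc_le v 3"
  shows "\<exists>w z. greedy_start x y w z"
proof -
  obtain w where w: "w \<in> verts G - {x, y}" "ecc_le w 2"
    using dom_pair_central[OF dp r] by blast
  have "x \<in> verts G" "y \<in> verts G" using dp unfolding dom_pair_def by auto
  then obtain z where z: "z \<in> verts G - {x, y, w}"
    using dom_pair_card[OF dp nu, of w] w by blast
  then have "greedy_start x y w z"
    unfolding greedy_start_def using dp w diam[of z] unfolding ecc_le_def by blast
  then show ?thesis by blast
qed

text \<open>The vertex \<open>w\<close> reaches neighbours of \<open>x\<close> over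
  \<open>x\<close>, and those of \<open>y\<close> by assumption. For \<open>z\<close> the neighbour
  \<open>b\<close> of \<open>y\<close> on a shortest path is taken.\<close>

lemma greedy_start_exists_dist_3:
  assumes dp: "dom_pair x y" and d3: "\<delta> x y = 3" and w: "w \<in> verts G" "\<delta> x w = 1"
    and w2: "\<And>t. t \<in> verts G \<Longrightarrow> \<delta> y t = 1 \<Longrightarrow> \<delta> w t \<le> 2"
  shows "\<exists>z. greedy_start x y w z"
  using dp
proof (cases rule: dom_pair_cases)
  case (path a b)
  have xy: "x \<in> verts G" "y \<in> verts G" using dp unfolding dom_pair_def by auto
  have "\<delta> b a = 1" using path \<delta>_sym[of a b] by simp
  then have b3: "ecc_le b 3" using path_ecc[OF dom_pair_sym[OF dp]] path by blast
  have "b \<noteq> x" "b \<noteq> y" "w \<noteq> x" "w \<noteq> y" using path w d3 xy \<delta>_sym[of x y] by auto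
  \<comment> \<open>As a common neighbour of \<open>x\<close> and \<open>y\<close>, it would
    contradict their distance 3.\<close>
  moreover have "b \<noteq> w"
    using path w d3 xy \<delta>_triangle[of x w y] \<delta>_sym[of w y] by auto
  moreover have "\<delta> w u \<le> 2" if u: "u \<in> verts G - {x, y}" for u
  proof -
    have "\<delta> x u = 1 \<or> \<delta> y u = 1" using dp u unfolding dom_pair_def by blast
    then show ?thesis
      using w2 u \<delta>_triangle[of w x u] \<delta>_sym[of w x] w xy by auto
  qed
  ultimately have "greedy_start x y w b"
    unfolding greedy_start_def using dp w path b3 unfolding ecc_le_def by auto
  then show ?thesis by blast
qed (use d3 in simp)

section \<open>Translating the four conditions\<close>

text \<open>No eccentricity is below the radius, so an upper bound is enough.\<close>

lemma central_vertex_iff: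
  assumes "rad G = enat k"
  shows "central_vertex G v \<longleftrightarrow> v \<in> verts G \<and> ecc_le v k"
proof -
  have "rad G \<le> eccentricity G v" if "v \<in> verts G"
    unfolding rad_def using that by simp
  then show ?thesis
    unfolding central_vertex_def using assms eccentricity_le_iff[of v k] by auto
qed

text \<open>No eccentricity exceeds the diameter, so missing it means being at least one
  smaller.\<close>

lemma diametrical_vertex_iff:
  assumes "diam G = enat (Suc k)" "v \<in> verts G"
  shows "\<not> diametrical_vertex G v \<longleftrightarrow> ecc_le v k"
proof -
  have "eccentricity G v \<le> enat (Suc k)"
    using assms unfolding diam_def by (metis Max_ge finite_imageI finite_verts imageI)
  then show ?thesis
    unfolding diametrical_vertex_def
    using assms eccentricity_le_iff[of v k] enat_eq_Suc_iff[of "eccentricity G v" k] by auto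
qed

text \<open>Distance 3 already forces \<open>x\<close> and \<open>y\<close> to be distinct, which
  condition (iii) does not state separately.\<close>

lemma maximal_independent_pair_dist_3:
  "maximal_independent_set G {x, y} \<and> gdist G x y = 3 \<longleftrightarrow> dom_pair x y \<and> \<delta> x y = 3"
proof -
  have V: "x \<in> verts G" "y \<in> verts G" if "maximal_independent_set G {x, y}"
    using that unfolding maximal_independent_set_iff by auto
  have "x \<noteq> y" if "maximal_independent_set G {x, y}" "gdist G x y = 3"
    using V[OF that(1)] that(2) gdist_eq[of x y] by (auto simp: numeral_eq_enat zero_enat_def)
  then show ?thesis
    using V gdist_eq[of x y] maximal_independent_pair_iff[of x y] by (auto simp: numeral_eq_enat)
qed

lemma open_nbhd_iff:
  "x \<in> verts G \<Longrightarrow> w \<in> open_nbhd G x \<longleftrightarrow> w \<in> verts G \<and> \<delta> x w = 1"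
  unfolding open_nbhd_def using adj_iff by auto

text \<open>Both sides are compared with the existence of a \<open>greedy_start\<close>, after all
  conditions have been rewritten with \<open>ecc_le\<close> and \<open>dom_pair\<close>.\<close>

theorem grundy_packing_number_eq_pred:
  "grundy_packing_number G = card (verts G) - 1 \<longleftrightarrow>
    indep_dom_number G = 2 \<and>
    diam G \<le> 4 \<and>
    (rad G = 3 \<longrightarrow>
      (\<exists>x y. maximal_independent_set G {x, y} \<and> gdist G x y = 3 \<and>
        (\<exists>w \<in> open_nbhd G x. \<forall>z \<in> open_nbhd G y. gdist G w z \<le> 2))) \<and>
    (rad G = 2 \<and> diam G = 4 \<longrightarrow>
      (\<exists>A. maximal_independent_set G A \<and> card A = 2 \<and>
        (\<exists>w z. central_vertex G w \<and> z \<in> verts G \<and> \<not> diametrical_vertex G z \<and>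
          z \<noteq> w \<and> w \<notin> A \<and> z \<notin> A)))"
    (is "_ \<longleftrightarrow> _ \<and> _ \<and> (_ \<longrightarrow> ?iii) \<and> (_ \<longrightarrow> ?iv)")
proof -
  let ?V = "verts G"
  have rad3: "rad G = 3 \<longleftrightarrow> (\<exists>v\<in>?V. ecc_le v 3) \<and> \<not> (\<exists>v\<in>?V. ecc_le v 2)"
    using enat_eq_Suc_iff[of "rad G" 2] by (simp add: rad_le_iff numeral_eq_enat)
  have diam4: "diam G \<le> 4 \<longleftrightarrow> (\<forall>v\<in>?V. ecc_le v 4)"
    using diam_le_iff[of 4] by (simp add: numeral_eq_enat)
  have diam4': "diam G = 4 \<longleftrightarrow> diam G \<le> 4 \<and> \<not> (\<forall>v\<in>?V. ecc_le v 3)"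
    using enat_eq_Suc_iff[of "diam G" 3] by (simp add: diam_le_iff numeral_eq_enat)
  have universal1: "(\<exists>u. universal u) \<longleftrightarrow> rad G \<le> enat 1"
    unfolding universal_def rad_le_iff by blast
  have rad2: "rad G = 2 \<longleftrightarrow> (\<exists>v\<in>?V. ecc_le v 2) \<and> \<not> (\<exists>u. universal u)"
    using enat_eq_Suc_iff[of "rad G" 1] unfolding universal1 by (simp add: rad_le_iff numeral_eq_enat numeral_2_eq_2)
  have iii: "?iii \<longleftrightarrow> (\<exists>x y w. dom_pair x y \<and> \<delta> x y = 3 \<and> w \<in> ?V \<and> \<delta> x w = 1 \<and>
      (\<forall>t\<in>?V. \<delta> y t = 1 \<longrightarrow> \<delta> w t \<le> 2))"
  proof -
    define P where "P x y \<longleftrightarrow> (\<exists>w \<in> open_nbhd G x. \<forall>z \<in> open_nbhd G y. gdist G w z \<le> 2)" for x y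
    define Q where "Q x y \<longleftrightarrow> (\<exists>w. w \<in> ?V \<and> \<delta> x w = 1 \<and>
      (\<forall>t\<in>?V. \<delta> y t = 1 \<longrightarrow> \<delta> w t \<le> 2))" for x y
    have "P x y \<longleftrightarrow> Q x y" if "dom_pair x y" for x y
    proof -
      have "x \<in> ?V" "y \<in> ?V" using that unfolding dom_pair_def by auto
      then show ?thesis
        unfolding P_def Q_def by (auto simp: open_nbhd_iff Bex_def Ball_def gdist_eq numeral_eq_enat)
    qed
    then have "(\<exists>x y. (maximal_independent_set G {x, y} \<and> gdist G x y = 3) \<and> P x y) \<longleftrightarrow>
        (\<exists>x y. (dom_pair x y \<and> \<delta> x y = 3) \<and> Q x y)"
      unfolding maximal_independent_pair_dist_3 by blast
    then show ?thesis unfolding P_def Q_def by simp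
  qed
  \<comment> \<open>Conditional, because central and non-diametrical become bounds 2 and 3 only for
    these values of radius and diameter.\<close>
  have iv: "?iv \<longleftrightarrow> (\<exists>x y. dom_pair x y \<and>
      (\<exists>c\<in>?V - {x, y}. \<exists>v\<in>?V - {x, y, c}. ecc_le c 2 \<and> ecc_le v 3))"
    if "rad G = 2" "diam G = 4"
  proof -
    have central: "central_vertex G v \<longleftrightarrow> v \<in> ?V \<and> ecc_le v 2" for v
      using central_vertex_iff[of 2] that by (simp add: numeral_eq_enat)
    have nondiam: "\<not> diametrical_vertex G v \<longleftrightarrow> ecc_le v 3" if "v \<in> ?V" for v
      using diametrical_vertex_iff[of 3 v] \<open>diam G = 4\<close> that by (simp add: numeral_eq_enat)
    have "?iv \<longleftrightarrow> (\<exists>x y. dom_pair x y \<and>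
        (\<exists>w z. central_vertex G w \<and> z \<in> verts G \<and> \<not> diametrical_vertex G z \<and>
          z \<noteq> w \<and> w \<notin> {x, y} \<and> z \<notin> {x, y}))"
      unfolding card_2_iff maximal_independent_pair_iff[symmetric] by blast
    moreover have "(\<exists>w z. central_vertex G w \<and> z \<in> verts G \<and> \<not> diametrical_vertex G z \<and>
          z \<noteq> w \<and> w \<notin> {x, y} \<and> z \<notin> {x, y}) \<longleftrightarrow>
        (\<exists>c\<in>?V - {x, y}. \<exists>v\<in>?V - {x, y, c}. ecc_le c 2 \<and> ecc_le v 3)" for x y
      unfolding central using nondiam by blast
    ultimately show ?thesis by simp
  qed
  show ?thesis
  proof
    assume "grundy_packing_number G = card ?V - 1"
    then obtain c where c: "grundy_packing_coloring G (card ?V - 1) c"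
      and nu: "\<not> (\<exists>u. universal u)"
      unfolding grundy_packing_number_eq_pred_iff full_coloring_iff_universal by blast
    obtain x y w z where gs: "greedy_start x y w z"
      using coloring_imp_greedy_start[OF c nu] by blast
    then have dp: "dom_pair x y" unfolding greedy_start_def by blast
    have "indep_dom_number G = 2" unfolding indep_dom_number_eq_2_iff using dp nu by blast
    moreover have "diam G \<le> 4" unfolding diam4 using greedy_start_diam[OF gs] by blast
    moreover have "rad G = 3 \<longrightarrow> ?iii"
      unfolding rad3 iii using greedy_start_rad_3[OF gs] by blast
    moreover have "?iv" if rd: "rad G = 2 \<and> diam G = 4"
    proof -
      obtain r where "r \<in> ?V" "ecc_le r 2" using rd rad2 by blast
      from greedy_start_rad_2[OF gs this] show ?thesis
        using dp by (intro iffD2[OF iv] exI conjI) (use rd in auto)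
    qed
    ultimately show "indep_dom_number G = 2 \<and> diam G \<le> 4 \<and> (rad G = 3 \<longrightarrow> ?iii) \<and>
        (rad G = 2 \<and> diam G = 4 \<longrightarrow> ?iv)" by blast
  next
    assume R: "indep_dom_number G = 2 \<and> diam G \<le> 4 \<and> (rad G = 3 \<longrightarrow> ?iii) \<and>
        (rad G = 2 \<and> diam G = 4 \<longrightarrow> ?iv)"
    then obtain x y where dp: "dom_pair x y" and nu: "\<not> (\<exists>u. universal u)"
      unfolding indep_dom_number_eq_2_iff by blast
    have "\<exists>x y w z. greedy_start x y w z"
    proof (cases "\<exists>r\<in>?V. ecc_le r 2")
      case True
      then obtain r where r: "r \<in> ?V" "ecc_le r 2" by blast
      show ?thesis
      proof (cases "\<forall>v\<in>?V. ecc_le v 3")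
        case True
        then show ?thesis using greedy_start_exists_diam_3[OF dp nu r] by blast
      next
        case False
        have "rad G = 2" using rad2 r nu by blast
        moreover have "diam G = 4" using diam4' R False by blast
        \<comment> \<open>The pair from condition (iv) replaces the one chosen above; bounds 2 and 3
          on all vertices are more than a greedy start asks for.\<close>
        ultimately obtain x y w z where "dom_pair x y" "w \<in> ?V - {x, y}" "z \<in> ?V - {x, y, w}"
          "ecc_le w 2" "ecc_le z 3"
          using iv R by blast
        then have "greedy_start x y w z" unfolding greedy_start_def ecc_le_def by blast
        then show ?thesis by blast
      qed
    next
      case False
      \<comment> \<open>The dominating pair bounds the radius by 3, so here it equals 3.\<close>
      then have "?iii" using R rad3 dom_pair_rad[OF dp] by blast
      then show ?thesis unfolding iii using greedy_start_exists_dist_3 by blast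
    qed
    then show "grundy_packing_number G = card ?V - 1"
      unfolding grundy_packing_number_eq_pred_iff full_coloring_iff_universal
      using greedy_start_imp_coloring R nu diam4 by blast
  qed
qed

end

theorem theorem10:
  fixes G :: "('a, 'b) pre_digraph" and n :: nat
  assumes "graph G" and "Digraph_Component.connected G" and "card (verts G) = n"
  shows "grundy_packing_number G = n - 1 \<longleftrightarrow>
    indep_dom_number G = 2 \<and>
    diam G \<le> 4 \<and>
    (rad G = 3 \<longrightarrow>
      (\<exists>x y. maximal_independent_set G {x, y} \<and> gdist G x y = 3 \<and>
        (\<exists>w \<in> open_nbhd G x. \<forall>z \<in> open_nbhd G y. gdist G w z \<le> 2))) \<and>
    (rad G = 2 \<and> diam G = 4 \<longrightarrow>
      (\<exists>A. maximal_independent_set G A \<and> card A = 2 \<and>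
        (\<exists>w z. central_vertex G w \<and> z \<in> verts G \<and> \<not> diametrical_vertex G z \<and>
          z \<noteq> w \<and> w \<notin> A \<and> z \<notin> A)))"
proof -
  interpret connected_graph G
    using assms(1,2) by (simp add: connected_graph_def connected_graph_axioms_def)
  show ?thesis
    using grundy_packing_number_eq_pred unfolding assms(3) .
qed

end
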